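(* Let $R$ be a $*$-local ring, let $n\ge 1$, and let $A=\mathrm{M}(n,R)$ be the ring of $n\times n$ matrices over $R$ with the involution $(a_{ij})^*=(a_{ji}^* )$. Then $A$ is $*$-Euclidean.
   Context: All rings are associative with identity, not necessarily commutative. A ring with involution $(R,* )$ is a ring with an anti-automorphism $r\mapsto r^*$ satisfying $(r^* )^*=r$ (the identity is allowed when $R$ is commutative). For a ring with involution $A$: $A^\times$ is the group of units and $A^{\mathrm{sym}}=\{a\in A: a^*=a\}$. A ring is $l$-maximal if every maximal left ideal is a two-sided ideal. An ideal $\mathfrak{a}$ of a ring with involution is stable if $\mathfrak{a}^*=\mathfrak{a}$. A $*$-local ring is an $l$-maximal ring with involution having a unique stable maximal ideal, i.e. a unique ideal that is maximal among proper stable (two-sided) ideals. A ring with involution $(A,* )$ is $*$-Euclidean if for all $a,c\in A$ with $Aa+Ac=A$ and $a^*c\in A^{\mathrm{sym}}$, setting $r_{-1}=a$, $r_0=c$, there exist an integer $m\ge1$ and elements $s_0,\dots,s_{m-1}\in A^{\mathrm{sym}}$, $r_1,\dots,r_{m-1}\in A$, $r_m\in A^\times$ such that $r_{i-1}=s_ir_i+r_{i+1}$ for $i=0,\dots,m-1$. *)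

theory Defs
  imports "HOL-Algebra.Algebra" "Jordan_Normal_Form.VS_Connect"
begin

locale ring_with_involution = ring R
  for R :: "('a, 'b) ring_scheme" (structure) and star :: "'a \<Rightarrow> 'a" +
  assumes star_closed: "x \<in> carrier R \<Longrightarrow> star x \<in> carrier R"
    and star_add: "\<lbrakk>x \<in> carrier R; y \<in> carrier R\<rbrakk> \<Longrightarrow> star (x \<oplus> y) = star x \<oplus> star y"
    and star_mult: "\<lbrakk>x \<in> carrier R; y \<in> carrier R\<rbrakk> \<Longrightarrow> star (x \<otimes> y) = star y \<otimes> star x"
    and star_star: "x \<in> carrier R \<Longrightarrow> star (star x) = x"

definition sym_elems :: "('a, 'b) ring_scheme \<Rightarrow> ('a \<Rightarrow> 'a) \<Rightarrow> 'a set" where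
  "sym_elems R star = {x \<in> carrier R. star x = x}"

definition left_ideal :: "'a set \<Rightarrow> ('a, 'b) ring_scheme \<Rightarrow> bool" where
  "left_ideal I R \<longleftrightarrow>
     additive_subgroup I R \<and> (\<forall>x \<in> carrier R. \<forall>a \<in> I. x \<otimes>\<^bsub>R\<^esub> a \<in> I)"

definition maximal_left_ideal :: "'a set \<Rightarrow> ('a, 'b) ring_scheme \<Rightarrow> bool" where
  "maximal_left_ideal I R \<longleftrightarrow>
     left_ideal I R \<and> I \<noteq> carrier R \<and>
     (\<forall>J. left_ideal J R \<and> I \<subseteq> J \<longrightarrow> J = I \<or> J = carrier R)"

(* The library predicate "ideal" means two-sided ideal. *)
definition l_maximal :: "('a, 'b) ring_scheme \<Rightarrow> bool" where
  "l_maximal R \<longleftrightarrow> (\<forall>I. maximal_left_ideal I R \<longrightarrow> ideal I R)"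

definition stable_ideal :: "'a set \<Rightarrow> ('a, 'b) ring_scheme \<Rightarrow> ('a \<Rightarrow> 'a) \<Rightarrow> bool" where
  "stable_ideal I R star \<longleftrightarrow> ideal I R \<and> star ` I = I"

(* Maximal among the proper stable ideals; need not be a maximal ideal of R. *)
definition stable_maximal_ideal :: "'a set \<Rightarrow> ('a, 'b) ring_scheme \<Rightarrow> ('a \<Rightarrow> 'a) \<Rightarrow> bool" where
  "stable_maximal_ideal I R star \<longleftrightarrow>
     stable_ideal I R star \<and> I \<noteq> carrier R \<and>
     (\<forall>J. stable_ideal J R star \<and> I \<subseteq> J \<longrightarrow> J = I \<or> J = carrier R)"

locale star_local_ring = ring_with_involution R star
  for R :: "('a, 'b) ring_scheme" (structure) and star :: "'a \<Rightarrow> 'a" +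
  assumes l_max: "l_maximal R"
    and unique_stable_maximal: "\<exists>!I. stable_maximal_ideal I R star"

(* The remainders r are indexed by int so that the indices run over -1, 0, ..., m. *)
locale star_Euclidean_ring = ring_with_involution R star
  for R :: "('a, 'b) ring_scheme" (structure) and star :: "'a \<Rightarrow> 'a" +
  assumes star_Euclidean:
    "\<lbrakk>a \<in> carrier R; c \<in> carrier R;
      {x \<otimes> a \<oplus> y \<otimes> c | x y. x \<in> carrier R \<and> y \<in> carrier R} = carrier R;
      star a \<otimes> c \<in> sym_elems R star\<rbrakk> \<Longrightarrow>
     \<exists>(m::int) (s :: int \<Rightarrow> 'a) (r :: int \<Rightarrow> 'a).
       m \<ge> 1 \<and> r (-1) = a \<and> r 0 = c \<and>
       (\<forall>i \<in> {0..m-1}. s i \<in> sym_elems R star) \<and>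
       (\<forall>i \<in> {1..m-1}. r i \<in> carrier R) \<and>
       r m \<in> Units R \<and>
       (\<forall>i \<in> {0..m-1}. r (i - 1) = s i \<otimes> r i \<oplus> r (i + 1))"

definition mat_star :: "('a \<Rightarrow> 'a) \<Rightarrow> 'a mat \<Rightarrow> 'a mat" where
  "mat_star star M = map_mat star (transpose_mat M)"

end

theory Submission
  imports Defs
begin

text \<open>
  One division step always suffices: if $(a,c)$ is a unimodular pair of $n \times n$ matrices
  and $a^*c$ is symmetric, there is a symmetric $s$ such that $a - sc$ is invertible.

  Choose a maximal left ideal $M$ of $R$ and put $N = M^*$. By \<open>l\<close>-maximality $M$ is two-sided, and
  $M \cap M^*$ is a maximal stable ideal, as it is for every other choice of $M$. Uniqueness of
  that ideal and primeness of maximal left ideals leave $M$ and $N$ as the only maximal left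
  ideals. Hence an element outside $M \cup N$ is a unit
  (\<open>star_local_conjugate_ideals\<close>). The rest of the proof uses only this pair of conjugate ideals.

  The matrix $s$ is found by induction on $n$. For invertible $g$ and $h$ the pair $(a,c)$ may be
  replaced by $(g^{-*}ah,\, gch)$, since $a - sc$ becomes $g^{-*}(a - sc)h$ with $s$ replaced by
  $g^{-*}sg^{-1}$. If $c$ has an entry outside $M$ and an entry outside $N$, elementary operations
  merge the two into one unit entry, so that $c$ may be assumed to be
  $\mathrm{diag}(1, c')$ (\<open>diagonal_pivot\<close>). With $a$ in the corresponding blocks $p, b, d, q$,
  symmetry of $a^*c$ says that $p$ is symmetric, that $b = d^*c'$, and that $q^*c'$ is symmetric;
  the induction hypothesis applies to $(q,c')$ and gives $s'$. The symmetric matrix with blocks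
  $p-1,\, d^*,\, d,\, s'$ then turns $a$ into $\mathrm{diag}(1,\, q - s'c')$.

  If all entries of $c$ lie in $N$, say, then they also lie in $M$
  (\<open>in_mats_conjugate\<close>), the rank-zero case of the fact that $c$ has equal ranks over $R/M$ and
  $R/N$. In that case $a$ has a left inverse modulo $M$ and modulo $N$, so it is invertible
  (\<open>unit_if_left_invertible_mod\<close>, again by pivoting), and $s = 0$ works.
\<close>

section \<open>Invertible matrices over a noncommutative ring\<close>

abbreviation mat_units :: "nat \<Rightarrow> 'a::ring_1 mat set" where
  "mat_units n \<equiv> Units (ring_mat TYPE('a) n ())"

lemma mat_units_iff:
  "A \<in> mat_units n \<longleftrightarrow>
     A \<in> carrier_mat n n \<and> (\<exists>B \<in> carrier_mat n n. A * B = 1\<^sub>m n \<and> B * A = 1\<^sub>m n)"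
  by (auto simp: Units_def ring_mat_simps)

lemma mat_unitsI:
  assumes "A \<in> carrier_mat n n" "B \<in> carrier_mat n n" "A * B = 1\<^sub>m n" "B * A = 1\<^sub>m n"
  shows "A \<in> mat_units n"
  using assms by (auto simp: mat_units_iff)

lemma mat_unitsE:
  assumes "A \<in> mat_units n"
  obtains B where "B \<in> mat_units n" "A \<in> carrier_mat n n" "B \<in> carrier_mat n n"
    "A * B = 1\<^sub>m n" "B * A = 1\<^sub>m n"
  using assms by (auto simp: mat_units_iff)

lemma ring_mat_ring_1: "ring (ring_mat TYPE('a::ring_1) n b)"
  by (unfold_locales, insert add_inv_exists_mat,
      auto simp: ring_mat_def algebra_simps Units_def)

lemma mat_units_mult:
  assumes "A \<in> mat_units n" "B \<in> mat_units n"
  shows "A * B \<in> mat_units n"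
proof -
  interpret ring "ring_mat TYPE('a) n ()" by (rule ring_mat_ring_1)
  show ?thesis using Units_m_closed[OF assms] by (simp add: ring_mat_simps)
qed

lemma mult_cancel_inverse:
  fixes A :: "'a::ring_1 mat"
  assumes "A \<in> carrier_mat n n" "B \<in> carrier_mat n n" "C \<in> carrier_mat n n" "A * B = 1\<^sub>m n"
  shows "A * (B * C) = C"
  using assms assoc_mult_mat[OF assms(1,2,3)] by simp

lemma conj_unit_cancel:
  fixes A :: "'a::ring_1 mat"
  assumes "g \<in> mat_units n" "h \<in> mat_units n" "A \<in> carrier_mat n n" "g * A * h \<in> mat_units n"
  shows "A \<in> mat_units n"
proof -
  obtain g' where g: "g' \<in> mat_units n" "g \<in> carrier_mat n n" "g' \<in> carrier_mat n n" "g' * g = 1\<^sub>m n"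
    using assms(1) by (rule mat_unitsE)
  obtain h' where h: "h' \<in> mat_units n" "h \<in> carrier_mat n n" "h' \<in> carrier_mat n n" "h * h' = 1\<^sub>m n"
    using assms(2) by (rule mat_unitsE)
  have "g' * (g * A * h) * h' = A"
    using g h assms(3) by (simp add: assoc_mult_mat[of _ n n _ n _ n] mult_cancel_inverse)
  then show ?thesis using mat_units_mult[OF mat_units_mult[OF g(1) assms(4)] h(1)] by simp
qed

lemma uminus_zero_mat: "- (0\<^sub>m n m) = (0\<^sub>m n m :: 'a::ring_1 mat)"
  by (rule eq_matI) auto

lemma four_block_mult_Suc:
  fixes A1 :: "'a::ring_1 mat"
  assumes "A1 \<in> carrier_mat 1 1" "B1 \<in> carrier_mat 1 n" "C1 \<in> carrier_mat n 1" "D1 \<in> carrier_mat n n"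
    and "A2 \<in> carrier_mat 1 1" "B2 \<in> carrier_mat 1 n" "C2 \<in> carrier_mat n 1" "D2 \<in> carrier_mat n n"
  shows "four_block_mat A1 B1 C1 D1 * four_block_mat A2 B2 C2 D2 =
    four_block_mat (A1 * A2 + B1 * C2) (A1 * B2 + B1 * D2) (C1 * A2 + D1 * C2) (C1 * B2 + D1 * D2)"
  by (rule mult_four_block_mat[OF assms])

lemma four_block_one_Suc:
  "four_block_mat (1\<^sub>m 1) (0\<^sub>m 1 n) (0\<^sub>m n 1) (1\<^sub>m n) = (1\<^sub>m (Suc n) :: 'a::ring_1 mat)"
  using four_block_one_mat[of 1 n] by simp

lemma four_block_cases_Suc:
  assumes "A \<in> carrier_mat (Suc n) (Suc n)"
  obtains P B C D where "P \<in> carrier_mat 1 1" "B \<in> carrier_mat 1 n" "C \<in> carrier_mat n 1"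
    "D \<in> carrier_mat n n" "A = four_block_mat P B C D"
proof -
  obtain P B C D where s: "split_block A 1 1 = (P, B, C, D)" by (metis prod_cases4)
  show ?thesis using that split_block[OF s, of n n] assms by simp
qed

lemma four_block_inject:
  assumes eq: "four_block_mat A1 B1 C1 D1 = four_block_mat A2 B2 C2 D2"
    and 1: "A1 \<in> carrier_mat nr nc" "B1 \<in> carrier_mat nr m" "C1 \<in> carrier_mat k nc" "D1 \<in> carrier_mat k m"
    and 2: "A2 \<in> carrier_mat nr nc" "B2 \<in> carrier_mat nr m" "C2 \<in> carrier_mat k nc" "D2 \<in> carrier_mat k m"
  shows "A1 = A2" "B1 = B2" "C1 = C2" "D1 = D2"
proof -
  have ij: "four_block_mat A1 B1 C1 D1 $$ (i,j) = four_block_mat A2 B2 C2 D2 $$ (i,j)" for i j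
    using eq by simp
  show "A1 = A2"
  proof (rule eq_matI)
    fix i j assume "i < dim_row A2" "j < dim_col A2"
    then show "A1 $$ (i,j) = A2 $$ (i,j)" using ij[of i j] 1 2 by auto
  qed (use 1 2 in auto)
  show "B1 = B2"
  proof (rule eq_matI)
    fix i j assume "i < dim_row B2" "j < dim_col B2"
    then show "B1 $$ (i,j) = B2 $$ (i,j)" using ij[of i "j + nc"] 1 2 by auto
  qed (use 1 2 in auto)
  show "C1 = C2"
  proof (rule eq_matI)
    fix i j assume "i < dim_row C2" "j < dim_col C2"
    then show "C1 $$ (i,j) = C2 $$ (i,j)" using ij[of "i + nr" j] 1 2 by auto
  qed (use 1 2 in auto)
  show "D1 = D2"
  proof (rule eq_matI)
    fix i j assume "i < dim_row D2" "j < dim_col D2"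
    then show "D1 $$ (i,j) = D2 $$ (i,j)" using ij[of "i + nr" "j + nc"] 1 2 by auto
  qed (use 1 2 in auto)
qed

lemma four_block_diag_unit:
  fixes U :: "'a::ring_1 mat"
  assumes "U \<in> mat_units n"
  shows "four_block_mat (1\<^sub>m 1) (0\<^sub>m 1 n) (0\<^sub>m n 1) U \<in> mat_units (Suc n)"
proof -
  obtain V where V: "U \<in> carrier_mat n n" "V \<in> carrier_mat n n" "U * V = 1\<^sub>m n" "V * U = 1\<^sub>m n"
    using assms by (rule mat_unitsE)
  show ?thesis
    by (rule mat_unitsI[where B = "four_block_mat (1\<^sub>m 1) (0\<^sub>m 1 n) (0\<^sub>m n 1) V"])
       (use V in \<open>auto simp: four_block_mult_Suc[where n = n]\<close>)
qed

lemma four_block_upper_unit: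
  fixes B :: "'a::ring_1 mat"
  assumes B: "B \<in> carrier_mat 1 n"
  shows "four_block_mat (1\<^sub>m 1) B (0\<^sub>m n 1) (1\<^sub>m n) \<in> mat_units (Suc n)"
proof (rule mat_unitsI[where B = "four_block_mat (1\<^sub>m 1) (- B) (0\<^sub>m n 1) (1\<^sub>m n)"])
  have [simp]: "- B + B = 0\<^sub>m 1 n" "B + - B = 0\<^sub>m 1 n" using B by auto
  note mult = four_block_mult_Suc[where n = n]
  show "four_block_mat (1\<^sub>m 1) B (0\<^sub>m n 1) (1\<^sub>m n) * four_block_mat (1\<^sub>m 1) (- B) (0\<^sub>m n 1) (1\<^sub>m n) = 1\<^sub>m (Suc n)"
    using B by (subst mult) (auto simp: uminus_zero_mat)
  show "four_block_mat (1\<^sub>m 1) (- B) (0\<^sub>m n 1) (1\<^sub>m n) * four_block_mat (1\<^sub>m 1) B (0\<^sub>m n 1) (1\<^sub>m n) = 1\<^sub>m (Suc n)"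
    using B by (subst mult) (auto simp: uminus_zero_mat)
qed (use B in auto)

lemma four_block_lower_unit:
  fixes P :: "'a::ring_1 mat"
  assumes P: "P \<in> carrier_mat 1 1" "Q \<in> carrier_mat 1 1" "P * Q = 1\<^sub>m 1" "Q * P = 1\<^sub>m 1"
    and D: "D \<in> carrier_mat n 1"
  shows "four_block_mat Q (0\<^sub>m 1 n) (- (D * Q)) (1\<^sub>m n) \<in> mat_units (Suc n)"
proof (rule mat_unitsI[where B = "four_block_mat P (0\<^sub>m 1 n) D (1\<^sub>m n)"])
  have DQP: "D * Q * P = D" using P D by (simp add: assoc_mult_mat[of D n 1 Q 1 P 1])
  have "- (D * Q) * P = - D" using P D DQP by simp
  then have [simp]: "- (D * Q) * P + D = 0\<^sub>m n 1" using D by simp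
  have [simp]: "D * Q + - (D * Q) = 0\<^sub>m n 1" using P D by auto
  note mult = four_block_mult_Suc[where n = n]
  show "four_block_mat Q (0\<^sub>m 1 n) (- (D * Q)) (1\<^sub>m n) * four_block_mat P (0\<^sub>m 1 n) D (1\<^sub>m n) = 1\<^sub>m (Suc n)"
    using P D by (subst mult) (auto simp: uminus_zero_mat)
  show "four_block_mat P (0\<^sub>m 1 n) D (1\<^sub>m n) * four_block_mat Q (0\<^sub>m 1 n) (- (D * Q)) (1\<^sub>m n) = 1\<^sub>m (Suc n)"
    using P D by (subst mult) (auto simp: uminus_zero_mat)
qed (use P D in auto)

text \<open>
  Gaussian elimination on both sides. The order of the factors matters: the pivot inverse $q$ acts
  from the left on its row, and $-cq$ acts from the left on the rows below.
\<close>

lemma clear_unit_pivot: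
  fixes A :: "'a::ring_1 mat"
  assumes A: "A \<in> carrier_mat (Suc n) (Suc n)"
    and q: "A $$ (0,0) * q = 1" "q * A $$ (0,0) = 1"
  obtains g h A' where "g \<in> mat_units (Suc n)" "h \<in> mat_units (Suc n)" "A' \<in> carrier_mat n n"
    "g * A * h = four_block_mat (1\<^sub>m 1) (0\<^sub>m 1 n) (0\<^sub>m n 1) A'"
proof -
  obtain P B C D where b: "P \<in> carrier_mat 1 1" "B \<in> carrier_mat 1 n" "C \<in> carrier_mat n 1"
    "D \<in> carrier_mat n n" and AA: "A = four_block_mat P B C D"
    using four_block_cases_Suc[OF A] by blast
  define Q where "Q = mat 1 1 (\<lambda>_. q)"
  have Q: "Q \<in> carrier_mat 1 1" by (simp add: Q_def)
  have p: "P $$ (0,0) = A $$ (0,0)" using b by (simp add: AA)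
  have PQ: "P * Q = 1\<^sub>m 1" "Q * P = 1\<^sub>m 1"
    using b(1) q by (auto intro!: eq_matI simp: Q_def scalar_prod_def p)
  define g where "g = four_block_mat Q (0\<^sub>m 1 n) (- (C * Q)) (1\<^sub>m n)"
  define h where "h = four_block_mat (1\<^sub>m 1) (- (Q * B)) (0\<^sub>m n 1) (1\<^sub>m n)"
  define A' where "A' = - (C * Q) * B + D"
  have CQP: "C * Q * P = C" using b Q PQ by (simp add: assoc_mult_mat[of C n 1 Q 1 P 1])
  have "- (C * Q) * P = - C" using b Q CQP by simp
  then have [simp]: "- (C * Q) * P + C = 0\<^sub>m n 1" using b by simp
  have A': "A' \<in> carrier_mat n n" unfolding A'_def using b Q by auto
  have QB: "- (Q * B) + Q * B = 0\<^sub>m 1 n" using b Q by auto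
  note mult = four_block_mult_Suc[where n = n]
  have "g * A = four_block_mat (1\<^sub>m 1) (Q * B) (0\<^sub>m n 1) A'"
    unfolding g_def AA using b Q PQ by (subst mult) (auto simp: A'_def)
  then have "g * A * h = four_block_mat (1\<^sub>m 1) (0\<^sub>m 1 n) (0\<^sub>m n 1) A'"
    unfolding h_def using b Q A' by (simp add: mult QB[simplified] uminus_zero_mat)
  moreover have "g \<in> mat_units (Suc n)" unfolding g_def by (rule four_block_lower_unit[OF b(1) Q PQ b(3)])
  moreover have "h \<in> mat_units (Suc n)" unfolding h_def
    by (rule four_block_upper_unit) (use b Q in auto)
  ultimately show ?thesis using that A' by blast
qed

text \<open>
  With $w_j = 0$ this is the identity plus the column $w$ in position $j$, which adds left multiples
  of row $j$ to the other rows; its inverse is the transvection of $-w$.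
\<close>

definition transvection :: "nat \<Rightarrow> nat \<Rightarrow> (nat \<Rightarrow> 'a::ring_1) \<Rightarrow> 'a mat" where
  "transvection n j w = mat n n (\<lambda>(i,k). (if i = k then 1 else 0) + (if k = j then w i else 0))"

lemma transvection_carrier: "transvection n j w \<in> carrier_mat n n"
  by (simp add: transvection_def)

lemma transvection_mult_index:
  fixes B :: "'a::ring_1 mat"
  assumes "B \<in> carrier_mat n n" "j < n" "i < n" "l < n"
  shows "(transvection n j w * B) $$ (i,l) = B $$ (i,l) + w i * B $$ (j,l)"
proof -
  have "(transvection n j w * B) $$ (i,l) =
      (\<Sum>k\<in>{0..<n}. ((if i = k then 1 else 0) + (if k = j then w i else 0)) * B $$ (k,l))"
    using assms by (auto simp: transvection_def scalar_prod_def intro!: sum.cong)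
  also have "\<dots> = (\<Sum>k\<in>{0..<n}. (if i = k then B $$ (k,l) else 0) + (if k = j then w i * B $$ (k,l) else 0))"
    by (intro sum.cong) (auto simp: distrib_right)
  also have "\<dots> = B $$ (i,l) + w i * B $$ (j,l)"
    using assms by (simp add: sum.distrib sum.delta)
  finally show ?thesis .
qed

lemma transvection_unit:
  assumes "j < n" "w j = (0::'a::ring_1)"
  shows "transvection n j w \<in> mat_units n"
proof -
  have inv: "transvection n j v * transvection n j (\<lambda>i. - v i) = 1\<^sub>m n" if "v j = 0" for v :: "nat \<Rightarrow> 'a"
  proof (rule eq_matI)
    fix i l assume "i < dim_row (1\<^sub>m n :: 'a mat)" "l < dim_col (1\<^sub>m n :: 'a mat)"
    then have il: "i < n" "l < n" by auto
    show "(transvection n j v * transvection n j (\<lambda>i. - v i)) $$ (i,l) = 1\<^sub>m n $$ (i,l)"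
      using il assms(1) that
      by (subst transvection_mult_index[OF transvection_carrier]) (auto simp: transvection_def)
  qed (auto simp: transvection_def)
  show ?thesis
    by (rule mat_unitsI[where B = "transvection n j (\<lambda>i. - w i)"])
       (use inv[of w] inv[of "\<lambda>i. - w i"] assms(2) in \<open>auto simp: transvection_carrier\<close>)
qed

text \<open>
  A product of two transvections suffices: the first takes $e_0$ to $e_0 + e_j$, whose entry $1$ in
  position $j$ is then used to correct all the other entries. This realises any column with an
  entry $1$ without permutation matrices.
\<close>

lemma unit_with_first_column:
  fixes v :: "nat \<Rightarrow> 'a::ring_1"
  assumes "j < n" "v j = 1"
  obtains h where "h \<in> mat_units n" "\<And>i. i < n \<Longrightarrow> h $$ (i,0) = v i"
proof (cases "j = 0")
  case True
  let ?w = "v(0 := 0)"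
  show ?thesis
    by (rule that[of "transvection n 0 ?w"])
       (use assms True in \<open>auto simp: transvection_def intro!: transvection_unit[unfolded transvection_def]\<close>)
next
  case False
  define E where "E = transvection n 0 (\<lambda>i. if i = j then 1 else (0::'a))"
  define w where "w i = v i - E $$ (i,0)" for i
  have E: "E \<in> carrier_mat n n" by (simp add: E_def transvection_carrier)
  have Ej: "E $$ (j,0) = 1" using assms False by (simp add: E_def transvection_def)
  have "E \<in> mat_units n" unfolding E_def using assms False by (intro transvection_unit) auto
  moreover have "transvection n j w \<in> mat_units n"
    using assms Ej by (intro transvection_unit) (auto simp: w_def)
  ultimately have "transvection n j w * E \<in> mat_units n" by (rule mat_units_mult[rotated])
  moreover have "(transvection n j w * E) $$ (i,0) = v i" if "i < n" for i
    using that assms by (subst transvection_mult_index[OF E]) (auto simp: Ej w_def)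
  ultimately show ?thesis using that by blast
qed

section \<open>Conjugate transposition\<close>

locale involution =
  fixes star :: "'a::ring_1 \<Rightarrow> 'a"
  assumes star_add: "star (x + y) = star x + star y"
    and star_mult: "star (x * y) = star y * star x"
    and star_star [simp]: "star (star x) = x"
begin

lemma star_zero [simp]: "star 0 = 0"
  using star_add[of 0 0] by simp

lemma star_one [simp]: "star 1 = 1"
  by (metis mult.left_neutral mult.right_neutral star_mult star_star)

lemma star_uminus: "star (- x) = - star x"
  using star_add[of x "- x"] by (simp add: eq_neg_iff_add_eq_0 add.commute)

lemma star_diff: "star (x - y) = star x - star y"
  using star_add[of x "- y"] by (simp add: star_uminus)

lemma star_sum: "star (sum f A) = (\<Sum>x\<in>A. star (f x))"
  by (induction A rule: infinite_finite_induct) (auto simp: star_add)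

lemma mat_star_carrier [simp]: "mat_star star A \<in> carrier_mat n m \<longleftrightarrow> A \<in> carrier_mat m n"
  by (auto simp: mat_star_def)

lemma mat_star_index [simp]:
  "i < dim_col A \<Longrightarrow> j < dim_row A \<Longrightarrow> mat_star star A $$ (i,j) = star (A $$ (j,i))"
  "dim_row (mat_star star A) = dim_col A" "dim_col (mat_star star A) = dim_row A"
  by (auto simp: mat_star_def)

lemma mat_star_mat_star [simp]: "mat_star star (mat_star star A) = A"
  by (rule eq_matI) auto

lemma mat_star_one [simp]: "mat_star star (1\<^sub>m n) = 1\<^sub>m n"
  by (rule eq_matI) auto

lemma mat_star_add:
  "A \<in> carrier_mat n m \<Longrightarrow> B \<in> carrier_mat n m \<Longrightarrow>
    mat_star star (A + B) = mat_star star A + mat_star star B"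
  by (rule eq_matI) (auto simp: star_add)

lemma mat_star_minus:
  "A \<in> carrier_mat n m \<Longrightarrow> B \<in> carrier_mat n m \<Longrightarrow>
    mat_star star (A - B) = mat_star star A - mat_star star B"
  by (rule eq_matI) (auto simp: star_diff)

lemma mat_star_mult:
  "A \<in> carrier_mat n m \<Longrightarrow> B \<in> carrier_mat m k \<Longrightarrow>
    mat_star star (A * B) = mat_star star B * mat_star star A"
  by (rule eq_matI) (auto simp: scalar_prod_def star_sum star_mult intro!: sum.cong)

lemma mat_star_four_block:
  assumes "A \<in> carrier_mat nr nc" "B \<in> carrier_mat nr m" "C \<in> carrier_mat k nc" "D \<in> carrier_mat k m"
  shows "mat_star star (four_block_mat A B C D) =
    four_block_mat (mat_star star A) (mat_star star C) (mat_star star B) (mat_star star D)"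
  using assms by (intro eq_matI) auto

lemma mat_star_unit:
  assumes "A \<in> mat_units n"
  shows "mat_star star A \<in> mat_units n"
proof -
  obtain B where B: "A \<in> carrier_mat n n" "B \<in> carrier_mat n n" "A * B = 1\<^sub>m n" "B * A = 1\<^sub>m n"
    using assms by (rule mat_unitsE)
  show ?thesis
    by (rule mat_unitsI[where B = "mat_star star B"])
       (use B in \<open>simp_all flip: mat_star_mult[of _ n n _ n]\<close>)
qed

end

section \<open>Matrices with entries in an ideal\<close>

locale proper_ideal =
  fixes M :: "'a::ring_1 set"
  assumes zero_in [simp]: "0 \<in> M"
    and add_in: "x \<in> M \<Longrightarrow> y \<in> M \<Longrightarrow> x + y \<in> M"
    and left_in: "x \<in> M \<Longrightarrow> r * x \<in> M"
    and right_in: "x \<in> M \<Longrightarrow> x * r \<in> M"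
    and one_notin: "1 \<notin> M"
begin

lemma uminus_in: "x \<in> M \<Longrightarrow> - x \<in> M"
  using left_in[of x "- 1"] by simp

lemma diff_in: "x \<in> M \<Longrightarrow> y \<in> M \<Longrightarrow> x - y \<in> M"
  using add_in[of x "- y"] uminus_in by simp

lemma sum_in: "(\<And>x. x \<in> A \<Longrightarrow> f x \<in> M) \<Longrightarrow> sum f A \<in> M"
  by (induction A rule: infinite_finite_induct) (auto intro: add_in)

lemma add_in_cancel: "x \<in> M \<Longrightarrow> x + y \<in> M \<longleftrightarrow> y \<in> M"
  by (metis add_in add_diff_cancel_left' diff_in)

definition mats :: "nat \<Rightarrow> 'a mat set" where
  "mats n = {A \<in> carrier_mat n n. \<forall>i<n. \<forall>j<n. A $$ (i,j) \<in> M}"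

lemma matsI: "A \<in> carrier_mat n n \<Longrightarrow> (\<And>i j. i < n \<Longrightarrow> j < n \<Longrightarrow> A $$ (i,j) \<in> M) \<Longrightarrow> A \<in> mats n"
  by (auto simp: mats_def)

lemma matsD: "A \<in> mats n \<Longrightarrow> A \<in> carrier_mat n n" "A \<in> mats n \<Longrightarrow> i < n \<Longrightarrow> j < n \<Longrightarrow> A $$ (i,j) \<in> M"
  by (auto simp: mats_def)

lemma mats_diff: "A \<in> mats n \<Longrightarrow> B \<in> mats n \<Longrightarrow> A - B \<in> mats n"
  by (auto simp: mats_def intro!: diff_in)

lemma mats_left:
  assumes "A \<in> mats n" "B \<in> carrier_mat n n"
  shows "B * A \<in> mats n"
  using assms by (auto simp: mats_def scalar_prod_def intro!: sum_in left_in)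

lemma mats_right:
  assumes "A \<in> mats n" "B \<in> carrier_mat n n"
  shows "A * B \<in> mats n"
  using assms by (auto simp: mats_def scalar_prod_def intro!: sum_in right_in)

lemma mats_uminus:
  assumes "A \<in> mats n"
  shows "- A \<in> mats n"
  using assms by (auto simp: mats_def intro!: uminus_in)

lemma one_notin_mats: "0 < n \<Longrightarrow> 1\<^sub>m n \<notin> mats n"
  using one_notin by (auto simp: mats_def)

lemma left_inverse_mod_notin:
  assumes "Z * A - 1\<^sub>m n \<in> mats n" "Z \<in> carrier_mat n n" "A \<in> carrier_mat n n" "0 < n"
  shows "A \<notin> mats n"
proof
  assume "A \<in> mats n"
  then have "Z * A - (Z * A - 1\<^sub>m n) \<in> mats n"
    using mats_diff[OF mats_left[OF _ assms(2)] assms(1)] by blast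
  moreover have "Z * A - (Z * A - 1\<^sub>m n) = 1\<^sub>m n"
    using assms by (intro eq_matI) auto
  ultimately show False using one_notin_mats assms(4) by simp
qed

text \<open>
  One-sided invertibility modulo an ideal survives the two-sided row and column operations that
  create a pivot, and (by the next lemma) passes to the block that is left after splitting the
  pivot off.
\<close>

lemma left_inverse_mod_conj:
  assumes Z: "Z * A - 1\<^sub>m n \<in> mats n" "Z \<in> carrier_mat n n" and A: "A \<in> carrier_mat n n"
    and gh: "g \<in> mat_units n" "h \<in> mat_units n"
  obtains Y where "Y \<in> carrier_mat n n" "Y * (g * A * h) - 1\<^sub>m n \<in> mats n"
proof -
  obtain g' where g: "g' \<in> mat_units n" "g \<in> carrier_mat n n" "g' \<in> carrier_mat n n" "g' * g = 1\<^sub>m n"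
    using gh(1) by (rule mat_unitsE)
  obtain h' where h: "h' \<in> mat_units n" "h \<in> carrier_mat n n" "h' \<in> carrier_mat n n" "h' * h = 1\<^sub>m n"
    using gh(2) by (rule mat_unitsE)
  have "h' * (Z * A - 1\<^sub>m n) * h = h' * Z * g' * (g * A * h) - 1\<^sub>m n"
    using g h Z(2) A
    by (simp add: assoc_mult_mat[of _ n n _ n _ n] mult_cancel_inverse
        mult_minus_distrib_mat[of _ n n _ n] minus_mult_distrib_mat[of _ n n _ _ n])
  then have "h' * Z * g' * (g * A * h) - 1\<^sub>m n \<in> mats n"
    using mats_right[OF mats_left[OF Z(1) h(3)] h(2)] by simp
  then show ?thesis using that[of "h' * Z * g'"] g h Z by auto
qed

lemma left_inverse_mod_block:
  assumes Z: "Z * four_block_mat (1\<^sub>m 1) (0\<^sub>m 1 n) (0\<^sub>m n 1) A - 1\<^sub>m (Suc n) \<in> mats (Suc n)"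
      "Z \<in> carrier_mat (Suc n) (Suc n)"
    and A: "A \<in> carrier_mat n n"
  obtains Y where "Y \<in> carrier_mat n n" "Y * A - 1\<^sub>m n \<in> mats n"
proof -
  obtain P B C D where b: "P \<in> carrier_mat 1 1" "B \<in> carrier_mat 1 n" "C \<in> carrier_mat n 1"
    "D \<in> carrier_mat n n" and XX: "Z = four_block_mat P B C D"
    using four_block_cases_Suc[OF Z(2)] by blast
  have eq: "Z * four_block_mat (1\<^sub>m 1) (0\<^sub>m 1 n) (0\<^sub>m n 1) A = four_block_mat P (B * A) C (D * A)"
    unfolding XX using b A by (subst four_block_mult_Suc[where n = n]) auto
  have "D * A - 1\<^sub>m n \<in> mats n"
  proof (rule matsI)
    fix i j assume ij: "i < n" "j < n"
    have "(Z * four_block_mat (1\<^sub>m 1) (0\<^sub>m 1 n) (0\<^sub>m n 1) A - 1\<^sub>m (Suc n)) $$ (Suc i, Suc j) \<in> M"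
      by (rule matsD(2)[OF Z(1)]) (use ij in auto)
    then show "(D * A - 1\<^sub>m n) $$ (i,j) \<in> M" unfolding eq using ij b A by simp
  qed (use b A in auto)
  then show ?thesis using that b by blast
qed

end

section \<open>A pivot outside two ideals\<close>

text \<open>
  Say that a column avoids an ideal if one of its entries in the rows $I$ lies outside the ideal.
  If neither of the columns $j$ and $l$ avoids both ideals, then column $j$ avoids only $M$ and
  column $l$ only $N$. Their sum then avoids both ideals, and it becomes
  the first column of $Ah$ when $h$ has first column $e_j + e_l$. The row set allows the same
  argument to be used for a single row.
\<close>

lemma merge_columns:
  fixes A :: "'a::ring_1 mat"
  assumes "proper_ideal M" "proper_ideal N"
    and A: "A \<in> carrier_mat n n" and I: "I \<subseteq> {..<n}"
    and M: "i\<^sub>1 \<in> I" "j < n" "A $$ (i\<^sub>1,j) \<notin> M"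
    and N: "i\<^sub>2 \<in> I" "l < n" "A $$ (i\<^sub>2,l) \<notin> N"
  obtains h i i' where "h \<in> mat_units n" "i \<in> I" "(A * h) $$ (i,0) \<notin> M"
    "i' \<in> I" "(A * h) $$ (i',0) \<notin> N"
proof -
  interpret M: proper_ideal M by fact
  interpret N: proper_ideal N by fact
  note result = that
  have column: "(A * h) $$ (i,0) = (\<Sum>k\<in>{0..<n}. A $$ (i,k) * v k)"
    if "h \<in> mat_units n" "\<And>k. k < n \<Longrightarrow> h $$ (k,0) = v k" "i \<in> I" for h v i
  proof -
    have "h \<in> carrier_mat n n" using that(1) by (simp add: mat_units_iff)
    moreover have "i < n" using that I by auto
    ultimately show ?thesis using A that M by (auto simp: scalar_prod_def)
  qed
  have single: thesis if k: "k < n" and MN: "i \<in> I" "A $$ (i,k) \<notin> M" "i' \<in> I" "A $$ (i',k) \<notin> N" for k i i'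
  proof -
    obtain h where h: "h \<in> mat_units n" "\<And>i. i < n \<Longrightarrow> h $$ (i,0) = (if i = k then 1 else 0::'a)"
      using unit_with_first_column[OF k, of "\<lambda>i. if i = k then 1 else 0"] by auto
    have "(A * h) $$ (x,0) = A $$ (x,k)" if "x \<in> I" for x
      by (subst column[OF h that]) (use k in \<open>simp_all add: sum.delta if_distrib[of "\<lambda>y. _ * y"] cong: if_cong\<close>)
    then show thesis using result[OF h(1)] MN by metis
  qed
  show thesis
  proof (cases "(\<exists>i\<in>I. A $$ (i,j) \<notin> N) \<or> (\<exists>i\<in>I. A $$ (i,l) \<notin> M)")
    case True
    then show thesis using single M N by blast
  next
    case False
    then have jl: "j \<noteq> l" using N by blast
    obtain h where h: "h \<in> mat_units n" "\<And>i. i < n \<Longrightarrow> h $$ (i,0) = (if i = j then 1 else 0) + (if i = l then 1 else 0::'a)"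
      using unit_with_first_column[OF M(2), of "\<lambda>i. (if i = j then 1 else 0) + (if i = l then 1 else 0)"] jl by auto
    have sum: "(A * h) $$ (x,0) = A $$ (x,j) + A $$ (x,l)" if "x \<in> I" for x
      by (subst column[OF h that])
         (use M N in \<open>simp_all add: sum.delta distrib_left sum.distrib if_distrib[of "\<lambda>y. _ * y"] cong: if_cong\<close>)
    have "(A * h) $$ (i\<^sub>1,0) \<notin> M"
      using False M by (simp add: sum add.commute[of "A $$ (_,j)"] M.add_in_cancel)
    moreover have "(A * h) $$ (i\<^sub>2,0) \<notin> N"
      using False N by (simp add: sum N.add_in_cancel)
    ultimately show thesis using result h(1) M N by blast
  qed
qed

section \<open>Rings with two conjugate maximal ideals\<close>

text \<open>
  In a \<open>*\<close>-local ring these are a maximal left ideal and its conjugate, which may coincide. The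
  conditions are symmetric in the two ideals.
\<close>

locale conjugate_ideals = involution star + M: proper_ideal M + N: proper_ideal N
  for star :: "'a::ring_1 \<Rightarrow> 'a" and M N :: "'a set" +
  assumes star_M: "x \<in> M \<Longrightarrow> star x \<in> N" and star_N: "x \<in> N \<Longrightarrow> star x \<in> M"
    and unit: "x \<notin> M \<Longrightarrow> x \<notin> N \<Longrightarrow> \<exists>y. x * y = 1 \<and> y * x = 1"
    and comaximal: "M \<noteq> N \<Longrightarrow> \<exists>e \<in> N. 1 - e \<in> M"
begin

text \<open>
  Merging columns produces a first column that avoids both ideals. The conjugate transpose turns it
  into a row, so that merging columns once more amounts to a row operation on the original matrix
  and brings an entry outside both ideals, that is a unit, to the corner.
\<close>

lemma diagonal_pivot:
  assumes A: "A \<in> carrier_mat (Suc n) (Suc n)" "A \<notin> M.mats (Suc n)" "A \<notin> N.mats (Suc n)"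
  obtains g h A' where "g \<in> mat_units (Suc n)" "h \<in> mat_units (Suc n)" "A' \<in> carrier_mat n n"
    "g * A * h = four_block_mat (1\<^sub>m 1) (0\<^sub>m 1 n) (0\<^sub>m n 1) A'"
proof -
  let ?n = "Suc n"
  obtain i\<^sub>1 j\<^sub>1 i\<^sub>2 j\<^sub>2 where ij: "i\<^sub>1 < ?n" "j\<^sub>1 < ?n" "A $$ (i\<^sub>1,j\<^sub>1) \<notin> M" "i\<^sub>2 < ?n" "j\<^sub>2 < ?n" "A $$ (i\<^sub>2,j\<^sub>2) \<notin> N"
    using A unfolding M.mats_def N.mats_def by blast
  obtain h i i' where h: "h \<in> mat_units ?n" and i: "i < ?n" "(A * h) $$ (i,0) \<notin> M"
    "i' < ?n" "(A * h) $$ (i',0) \<notin> N"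
    by (rule merge_columns[OF M.proper_ideal_axioms N.proper_ideal_axioms A(1), of "{..<?n}" i\<^sub>1 j\<^sub>1 i\<^sub>2 j\<^sub>2])
       (use ij in auto)
  have hc: "h \<in> carrier_mat ?n ?n" using h by (simp add: mat_units_iff)
  define B where "B = mat_star star (A * h)"
  have B: "B \<in> carrier_mat ?n ?n" unfolding B_def using A(1) hc by simp
  have "B $$ (0,i) = star ((A * h) $$ (i,0))" "B $$ (0,i') = star ((A * h) $$ (i',0))"
    unfolding B_def using i A(1) hc by (auto simp del: index_mult_mat(1))
  then have Bi: "B $$ (0,i) \<notin> N" "B $$ (0,i') \<notin> M"
    using i star_M star_N star_star by metis+
  obtain k where k: "k \<in> mat_units ?n" "(B * k) $$ (0,0) \<notin> M" "(B * k) $$ (0,0) \<notin> N"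
    by (rule merge_columns[OF M.proper_ideal_axioms N.proper_ideal_axioms B, of "{0}" 0 i' 0 i])
       (use i Bi in auto)
  have kc: "k \<in> carrier_mat ?n ?n" using k by (simp add: mat_units_iff)
  define g where "g = mat_star star k"
  have g: "g \<in> mat_units ?n" "g \<in> carrier_mat ?n ?n" using k mat_star_unit kc by (auto simp: g_def)
  have "mat_star star (B * k) = g * (A * h)"
    unfolding g_def by (subst mat_star_mult[OF B kc]) (simp add: B_def)
  then have "(g * (A * h)) $$ (0,0) = star ((B * k) $$ (0,0))"
    using B kc by (metis mat_star_index(1) carrier_matD index_mult_mat(2,3) zero_less_Suc)
  then have "(g * (A * h)) $$ (0,0) \<notin> M" "(g * (A * h)) $$ (0,0) \<notin> N"
    using k star_M star_N star_star by metis+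
  then obtain q where q: "(g * (A * h)) $$ (0,0) * q = 1" "q * (g * (A * h)) $$ (0,0) = 1"
    using unit by blast
  have gAh: "g * (A * h) \<in> carrier_mat ?n ?n" using g A(1) hc by auto
  obtain g' h' A' where r: "g' \<in> mat_units ?n" "h' \<in> mat_units ?n" "A' \<in> carrier_mat n n"
    "g' * (g * (A * h)) * h' = four_block_mat (1\<^sub>m 1) (0\<^sub>m 1 n) (0\<^sub>m n 1) A'"
    using clear_unit_pivot[OF gAh q] by blast
  have "g' \<in> carrier_mat ?n ?n" "h' \<in> carrier_mat ?n ?n" using r by (auto simp: mat_units_iff)
  then have "g' * g * A * (h * h') = g' * (g * (A * h)) * h'"
    using g hc A(1) by (simp add: assoc_mult_mat[of _ ?n ?n _ ?n _ ?n])
  then show thesis using that[of "g' * g" "h * h'" A'] r g h mat_units_mult by metis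
qed

text \<open>
  This replaces the statement that matrix rings over the division rings $R/M$ and $R/N$ are
  Dedekind-finite and that units lift modulo the radical. It is proved by pivoting: left
  invertibility modulo a proper ideal excludes that all entries lie in it. The two left inverses
  may differ, which is essential for its use in \<open>in_mats_conjugate\<close>.
\<close>

lemma unit_if_left_invertible_mod:
  assumes "A \<in> carrier_mat n n"
    and "Z \<in> carrier_mat n n" "Z * A - 1\<^sub>m n \<in> M.mats n"
    and "Y \<in> carrier_mat n n" "Y * A - 1\<^sub>m n \<in> N.mats n"
  shows "A \<in> mat_units n"
  using assms
proof (induction n arbitrary: A Z Y)
  case 0
  then show ?case by (intro mat_unitsI[of A 0 A]) auto
next
  case (Suc n)
  note A = Suc.prems(1)
  have notin: "A \<notin> M.mats (Suc n)" "A \<notin> N.mats (Suc n)"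
    using M.left_inverse_mod_notin N.left_inverse_mod_notin Suc.prems by blast+
  obtain g h A' where r: "g \<in> mat_units (Suc n)" "h \<in> mat_units (Suc n)" and A': "A' \<in> carrier_mat n n"
    and eq: "g * A * h = four_block_mat (1\<^sub>m 1) (0\<^sub>m 1 n) (0\<^sub>m n 1) A'"
    using diagonal_pivot[OF A notin] by blast
  obtain Z' where Z': "Z' \<in> carrier_mat (Suc n) (Suc n)" "Z' * (g * A * h) - 1\<^sub>m (Suc n) \<in> M.mats (Suc n)"
    using M.left_inverse_mod_conj[OF Suc.prems(3,2) A r] by blast
  obtain Y' where Y': "Y' \<in> carrier_mat (Suc n) (Suc n)" "Y' * (g * A * h) - 1\<^sub>m (Suc n) \<in> N.mats (Suc n)"
    using N.left_inverse_mod_conj[OF Suc.prems(5,4) A r] by blast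
  obtain Z'' where Z'': "Z'' \<in> carrier_mat n n" "Z'' * A' - 1\<^sub>m n \<in> M.mats n"
    using M.left_inverse_mod_block[OF Z'(2)[unfolded eq] Z'(1) A'] by blast
  obtain Y'' where Y'': "Y'' \<in> carrier_mat n n" "Y'' * A' - 1\<^sub>m n \<in> N.mats n"
    using N.left_inverse_mod_block[OF Y'(2)[unfolded eq] Y'(1) A'] by blast
  have "A' \<in> mat_units n" by (rule Suc.IH[OF A' Z'' Y''])
  then have "g * A * h \<in> mat_units (Suc n)" unfolding eq by (rule four_block_diag_unit)
  then show ?case by (rule conj_unit_cancel[OF r A])
qed

end

section \<open>Symmetric reduction of a unimodular pair\<close>

context conjugate_ideals
begin

lemma mats_star: "A \<in> N.mats n \<Longrightarrow> mat_star star A \<in> M.mats n"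
  by (auto simp: M.mats_def N.mats_def intro!: star_N)

lemma swapped: "conjugate_ideals star N M"
proof (intro conjugate_ideals.intro conjugate_ideals_axioms.intro)
  assume "N \<noteq> M"
  then obtain e where "e \<in> N" "1 - e \<in> M" using comaximal by blast
  then show "\<exists>e\<in>M. 1 - e \<in> N" by (intro bexI[of _ "1 - e"]) auto
qed (use star_M star_N unit in \<open>auto intro: involution_axioms M.proper_ideal_axioms N.proper_ideal_axioms\<close>)

text \<open>
  Modulo $M$ the identity $a^*c = c^*a$ reads $a^*c = 0$, and $a^*$ has the right inverse $w^*$. If
  $a^*$ were known to be left invertible modulo $M$, this would give $c = 0$ modulo $M$. To obtain
  a left inverse, $w^*$ is changed modulo $N$: if $M \neq N$, by comaximality there is $z$ congruent to $w^*$
  modulo $M$ and to $1$ modulo $N$. It has the left inverses $a^*$ modulo $M$ and $1$ modulo $N$, so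
  it is a unit, and $a^*$ is invertible modulo $M$.
\<close>

lemma in_mats_conjugate:
  assumes c: "A \<in> carrier_mat n n" "C \<in> carrier_mat n n" "W \<in> carrier_mat n n" "V \<in> carrier_mat n n"
    and unimodular: "W * A + V * C = 1\<^sub>m n"
    and sym: "mat_star star A * C = mat_star star C * A"
    and C: "C \<in> N.mats n"
  shows "C \<in> M.mats n"
proof (cases "M = N")
  case True
  then show ?thesis using C by simp
next
  case False
  then obtain e where e: "e \<in> N" "1 - e \<in> M" using comaximal by blast
  \<comment> \<open>the identity modulo $N$ and zero modulo $M$, so that subtracting $(w^* - 1)F$ from $w^*$ changes $w^*$ to $1$ modulo $N$ only\<close>
  define F where "F = (1 - e) \<cdot>\<^sub>m 1\<^sub>m n"
  have F: "F \<in> carrier_mat n n" "F \<in> M.mats n" "1\<^sub>m n - F \<in> N.mats n"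
    using e by (auto simp: F_def M.mats_def N.mats_def)
  let ?As = "mat_star star A" and ?Cs = "mat_star star C" and ?Ws = "mat_star star W" and ?Vs = "mat_star star V"
  have s: "?As \<in> carrier_mat n n" "?Cs \<in> carrier_mat n n" "?Ws \<in> carrier_mat n n" "?Vs \<in> carrier_mat n n"
    using c by auto
  have Cs: "?Cs \<in> M.mats n" using C by (rule mats_star)
  have "?As * ?Ws + ?Cs * ?Vs = mat_star star (W * A + V * C)"
    using c by (simp add: mat_star_add[of _ n n] mat_star_mult[of _ n n _ n])
  then have one: "?As * ?Ws + ?Cs * ?Vs = 1\<^sub>m n" by (simp add: unimodular)
  have "?As * ?Ws - 1\<^sub>m n = - (?Cs * ?Vs)"
    unfolding one[symmetric] using s by (intro eq_matI) auto
  then have AW: "?As * ?Ws - 1\<^sub>m n \<in> M.mats n"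
    using M.mats_uminus[OF M.mats_right[OF Cs s(4)]] by simp
  define K where "K = (?Ws - 1\<^sub>m n) * F"
  have K: "K \<in> carrier_mat n n" "K \<in> M.mats n"
    unfolding K_def
    using F(1) M.mats_left[OF F(2) minus_carrier_mat[OF one_carrier_mat], of ?Ws] by auto
  define Z where "Z = ?Ws - K"
  have Z: "Z \<in> carrier_mat n n" unfolding Z_def using s K by auto
  have "?As * Z - 1\<^sub>m n = (?As * ?Ws - 1\<^sub>m n) - ?As * K"
    unfolding Z_def mult_minus_distrib_mat[OF s(1,3) K(1)]
    using s K by (intro eq_matI) (auto simp del: index_mult_mat(1))
  then have AZ: "?As * Z - 1\<^sub>m n \<in> M.mats n"
    using M.mats_diff[OF AW M.mats_left[OF K(2) s(1)]] by simp
  have "(?Ws - 1\<^sub>m n) * (1\<^sub>m n - F) = (?Ws - 1\<^sub>m n) - K"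
    unfolding K_def using s F by (subst mult_minus_distrib_mat[of _ n n _ n]) auto
  also have "\<dots> = 1\<^sub>m n * Z - 1\<^sub>m n"
    using s K Z by (auto simp: Z_def intro!: eq_matI)
  finally have "1\<^sub>m n * Z - 1\<^sub>m n \<in> N.mats n"
    using N.mats_left[OF F(3) minus_carrier_mat[OF one_carrier_mat], of ?Ws] by simp
  then have "Z \<in> mat_units n"
    by (rule unit_if_left_invertible_mod[OF Z s(1) AZ one_carrier_mat])
  then obtain Z' where Z': "Z' \<in> carrier_mat n n" "Z * Z' = 1\<^sub>m n" by (rule mat_unitsE)
  \<comment> \<open>conjugation by the unit turns the right inverse of $a^*$ modulo $M$ into a left inverse\<close>
  have "Z * (?As * Z - 1\<^sub>m n) * Z' = Z * ?As - 1\<^sub>m n"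
    using Z Z' s by (simp add: assoc_mult_mat[of _ n n _ n _ n]
        mult_minus_distrib_mat[of _ n n _ n] minus_mult_distrib_mat[of _ n n _ _ n])
  then have ZA: "Z * ?As - 1\<^sub>m n \<in> M.mats n"
    using M.mats_right[OF M.mats_left[OF AZ Z] Z'(1)] by simp
  have "?As * C \<in> M.mats n" unfolding sym using Cs c(1) by (rule M.mats_right)
  then have "Z * (?As * C) \<in> M.mats n" using Z by (rule M.mats_left)
  then have "Z * (?As * C) - (Z * ?As - 1\<^sub>m n) * C \<in> M.mats n"
    using M.mats_right[OF ZA c(2)] by (rule M.mats_diff)
  also have "Z * (?As * C) - (Z * ?As - 1\<^sub>m n) * C = C"
  proof -
    have "(Z * ?As - 1\<^sub>m n) * C = Z * (?As * C) - C"
      using Z s c by (simp add: minus_mult_distrib_mat[of _ n n _ _ n] assoc_mult_mat[of _ n n _ n _ n])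
    moreover have "Z * (?As * C) \<in> carrier_mat n n" using Z s c by auto
    ultimately show ?thesis using c by (auto intro!: eq_matI simp del: index_mult_mat(1))
  qed
  finally show ?thesis .
qed

lemma unit_if_radical:
  assumes c: "A \<in> carrier_mat n n" "C \<in> carrier_mat n n" "W \<in> carrier_mat n n" "V \<in> carrier_mat n n"
    and unimodular: "W * A + V * C = 1\<^sub>m n"
    and C: "C \<in> M.mats n" "C \<in> N.mats n"
  shows "A \<in> mat_units n"
proof -
  have eq: "W * A - 1\<^sub>m n = - (V * C)"
    unfolding unimodular[symmetric] using c by (intro eq_matI) auto
  have "W * A - 1\<^sub>m n \<in> M.mats n" "W * A - 1\<^sub>m n \<in> N.mats n"
    unfolding eq using M.mats_uminus[OF M.mats_left[OF C(1) c(4)]]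
      N.mats_uminus[OF N.mats_left[OF C(2) c(4)]] by auto
  then show ?thesis using unit_if_left_invertible_mod c by blast
qed

lemma unit_if_no_pivot:
  assumes c: "A \<in> carrier_mat n n" "C \<in> carrier_mat n n" "W \<in> carrier_mat n n" "V \<in> carrier_mat n n"
    and unimodular: "W * A + V * C = 1\<^sub>m n"
    and sym: "mat_star star A * C = mat_star star C * A"
    and C: "C \<in> M.mats n \<or> C \<in> N.mats n"
  shows "A \<in> mat_units n"
  using C
proof
  assume M: "C \<in> M.mats n"
  show ?thesis
    using unit_if_radical[OF c unimodular M]
      conjugate_ideals.in_mats_conjugate[OF swapped c unimodular sym M] by blast
next
  assume N: "C \<in> N.mats n"
  show ?thesis
    using unit_if_radical[OF c unimodular _ N] in_mats_conjugate[OF c unimodular sym N] by blast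
qed

lemma symmetric_reduction:
  assumes "A \<in> carrier_mat n n" "C \<in> carrier_mat n n" "W \<in> carrier_mat n n" "V \<in> carrier_mat n n"
    and "W * A + V * C = 1\<^sub>m n"
    and "mat_star star A * C = mat_star star C * A"
  obtains S where "S \<in> carrier_mat n n" "mat_star star S = S" "A - S * C \<in> mat_units n"
proof -
  have "\<exists>S \<in> carrier_mat n n. mat_star star S = S \<and> A - S * C \<in> mat_units n"
    using assms
  proof (induction n arbitrary: A C W V)
    case 0
    \<comment> \<open>an empty matrix has no entry outside $M$, so this is an instance of the case without pivot\<close>
    have "C \<in> M.mats 0" using 0 by (simp add: M.mats_def)
    then have "A \<in> mat_units 0" using unit_if_no_pivot[OF 0] by blast
    moreover have "A - 0\<^sub>m 0 0 * C = A" "mat_star star (0\<^sub>m 0 0) = 0\<^sub>m 0 0" using 0 by (auto intro!: eq_matI)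
    ultimately show ?case by (intro bexI[of _ "0\<^sub>m 0 0"]) auto
  next
    case (Suc n)
    note A = Suc.prems(1) and C = Suc.prems(2) and W = Suc.prems(3) and V = Suc.prems(4)
      and unimodular = Suc.prems(5) and sym = Suc.prems(6)
    let ?n = "Suc n"
    note assoc = assoc_mult_mat[of _ ?n ?n _ ?n _ ?n]
    show ?case
    proof (cases "C \<in> M.mats ?n \<or> C \<in> N.mats ?n")
      case True
      have "A \<in> mat_units ?n" by (rule unit_if_no_pivot[OF Suc.prems True])
      moreover have "A - 0\<^sub>m ?n ?n * C = A" using A C by (auto intro!: eq_matI)
      moreover have "mat_star star (0\<^sub>m ?n ?n) = 0\<^sub>m ?n ?n" by (auto intro!: eq_matI)
      ultimately show ?thesis by (intro bexI[of _ "0\<^sub>m ?n ?n"]) auto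
    next
      case False
      then obtain g h C' where gh: "g \<in> mat_units ?n" "h \<in> mat_units ?n" and C': "C' \<in> carrier_mat n n"
        and gCh: "g * C * h = four_block_mat (1\<^sub>m 1) (0\<^sub>m 1 n) (0\<^sub>m n 1) C'"
        using diagonal_pivot[OF C] by blast
      obtain g' where g: "g \<in> carrier_mat ?n ?n" "g' \<in> carrier_mat ?n ?n" "g * g' = 1\<^sub>m ?n" "g' * g = 1\<^sub>m ?n"
        using gh(1) by (rule mat_unitsE)
      obtain h' where h: "h' \<in> mat_units ?n" "h \<in> carrier_mat ?n ?n" "h' \<in> carrier_mat ?n ?n"
          "h * h' = 1\<^sub>m ?n" "h' * h = 1\<^sub>m ?n"
        using gh(2) by (rule mat_unitsE)
      let ?gs = "mat_star star g" and ?gs' = "mat_star star g'" and ?hs = "mat_star star h"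
      let ?As = "mat_star star A" and ?Cs = "mat_star star C"
      have gs: "?gs \<in> carrier_mat ?n ?n" "?gs' \<in> carrier_mat ?n ?n" "?gs \<in> mat_units ?n"
        using g gh by (auto intro: mat_star_unit)
      have hs: "?hs \<in> carrier_mat ?n ?n" using h by auto
      have AC: "?As \<in> carrier_mat ?n ?n" "?Cs \<in> carrier_mat ?n ?n" using A C by auto
      have gs1: "?gs * ?gs' = 1\<^sub>m ?n" "?gs' * ?gs = 1\<^sub>m ?n"
        using g by (simp_all flip: mat_star_mult[of _ ?n ?n _ ?n])
      \<comment> \<open>the congruent pair: unimodularity and symmetry are inherited from the given one\<close>
      define A1 where "A1 = ?gs' * A * h"
      define C1 where "C1 = g * C * h"
      have A1: "A1 \<in> carrier_mat ?n ?n" and C1: "C1 \<in> carrier_mat ?n ?n"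
        using gs g h A C by (auto simp: A1_def C1_def)
      have star1: "mat_star star A1 = ?hs * ?As * g'" "mat_star star C1 = ?hs * ?Cs * ?gs"
        using gs g h hs A C AC by (simp_all add: A1_def C1_def mat_star_mult[of _ ?n ?n _ ?n] assoc)
      have "mat_star star A1 * C1 = ?hs * (?As * C) * h"
        unfolding star1 C1_def using g hs h AC C by (simp add: assoc mult_cancel_inverse)
      moreover have "mat_star star C1 * A1 = ?hs * (?Cs * A) * h"
        unfolding star1 A1_def using gs gs1 hs h AC A by (simp add: assoc mult_cancel_inverse)
      ultimately have sym1: "mat_star star A1 * C1 = mat_star star C1 * A1" by (simp add: sym)
      have "h' * (W * A + V * C) * h = 1\<^sub>m ?n" unfolding unimodular using h by simp
      moreover have "h' * (W * A + V * C) * h = h' * W * ?gs * A1 + h' * V * g' * C1"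
        unfolding A1_def C1_def using g gs gs1 h A C W V
        by (simp add: assoc mult_cancel_inverse mult_add_distrib_mat[of _ ?n ?n _ ?n]
            add_mult_distrib_mat[of _ ?n ?n _ _ ?n])
      ultimately have uni1: "h' * W * ?gs * A1 + h' * V * g' * C1 = 1\<^sub>m ?n" by simp
      obtain P B D Q where b: "P \<in> carrier_mat 1 1" "B \<in> carrier_mat 1 n" "D \<in> carrier_mat n 1"
        "Q \<in> carrier_mat n n" and A1b: "A1 = four_block_mat P B D Q"
        using four_block_cases_Suc[OF A1] by blast
      have C1b: "C1 = four_block_mat (1\<^sub>m 1) (0\<^sub>m 1 n) (0\<^sub>m n 1) C'" unfolding C1_def by (rule gCh)
      let ?Ps = "mat_star star P" and ?Bs = "mat_star star B" and ?Ds = "mat_star star D" and ?Qs = "mat_star star Q"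
      let ?C's = "mat_star star C'"
      have bs: "?Ps \<in> carrier_mat 1 1" "?Bs \<in> carrier_mat n 1" "?Ds \<in> carrier_mat 1 n" "?Qs \<in> carrier_mat n n"
        "?C's \<in> carrier_mat n n" using b C' by auto
      have zs: "mat_star star (0\<^sub>m 1 n) = 0\<^sub>m n 1" "mat_star star (0\<^sub>m n 1) = 0\<^sub>m 1 n"
        by (auto intro!: eq_matI)
      have sA: "mat_star star A1 = four_block_mat ?Ps ?Ds ?Bs ?Qs"
        unfolding A1b by (rule mat_star_four_block[OF b])
      have sC: "mat_star star C1 = four_block_mat (1\<^sub>m 1) (0\<^sub>m 1 n) (0\<^sub>m n 1) ?C's"
        unfolding C1b by (subst mat_star_four_block[of _ 1 1 _ n _ n]) (use C' in \<open>simp_all add: zs[simplified]\<close>)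
      have l: "mat_star star A1 * C1 = four_block_mat ?Ps (?Ds * C') ?Bs (?Qs * C')"
        unfolding sA C1b using bs C' by (subst four_block_mult_Suc[where n = n]) auto
      have r: "mat_star star C1 * A1 = four_block_mat P B (?C's * D) (?C's * Q)"
        unfolding sC A1b using b bs C' by (subst four_block_mult_Suc[where n = n]) auto
      note blocks = four_block_inject[OF sym1[unfolded l r], of 1 1 n n]
      have Ps: "?Ps = P" and B: "B = ?Ds * C'" and QC: "?Qs * C' = ?C's * Q"
        using blocks b bs C' by auto
      have WV: "h' * W * ?gs \<in> carrier_mat ?n ?n" "h' * V * g' \<in> carrier_mat ?n ?n"
        using h gs g W V by auto
      obtain W1 W2 W3 W4 where w: "W1 \<in> carrier_mat 1 1" "W2 \<in> carrier_mat 1 n" "W3 \<in> carrier_mat n 1"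
        "W4 \<in> carrier_mat n n" and Wb: "h' * W * ?gs = four_block_mat W1 W2 W3 W4"
        using four_block_cases_Suc[OF WV(1)] by blast
      obtain V1 V2 V3 V4 where v: "V1 \<in> carrier_mat 1 1" "V2 \<in> carrier_mat 1 n" "V3 \<in> carrier_mat n 1"
        "V4 \<in> carrier_mat n n" and Vb: "h' * V * g' = four_block_mat V1 V2 V3 V4"
        using four_block_cases_Suc[OF WV(2)] by blast
      have wa: "h' * W * ?gs * A1 = four_block_mat (W1 * P + W2 * D) (W1 * B + W2 * Q) (W3 * P + W4 * D) (W3 * B + W4 * Q)"
        unfolding Wb A1b by (rule four_block_mult_Suc[OF w b])
      have vc: "h' * V * g' * C1 = four_block_mat V1 (V2 * C') V3 (V4 * C')"
        unfolding Vb C1b using v C' by (subst four_block_mult_Suc[where n = n]) auto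
      have "four_block_mat (W1 * P + W2 * D + V1) (W1 * B + W2 * Q + V2 * C') (W3 * P + W4 * D + V3) (W3 * B + W4 * Q + V4 * C')
          = four_block_mat (1\<^sub>m 1) (0\<^sub>m 1 n) (0\<^sub>m n 1) (1\<^sub>m n)"
        unfolding four_block_one_Suc uni1[symmetric] wa vc
        by (rule add_four_block_mat[symmetric, of _ 1 1 _ n _ n]) (use w v b C' in auto)
      then have "W3 * B + W4 * Q + V4 * C' = 1\<^sub>m n"
        by (rule four_block_inject(4)[of _ _ _ _ _ _ _ _ 1 1 n n]) (use w v b C' in auto)
      \<comment> \<open>the corner block of the unimodularity relation, where $b = d^*c'$ turns the contribution of $b$ into a multiple of $c'$\<close>
      moreover have "W3 * B + W4 * Q + V4 * C' = W4 * Q + (W3 * ?Ds + V4) * C'"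
      proof -
        have "(W3 * ?Ds + V4) * C' = W3 * ?Ds * C' + V4 * C'"
          by (rule add_mult_distrib_mat[of _ n n _ _ n]) (use w v bs C' in auto)
        also have "W3 * ?Ds * C' = W3 * B"
          unfolding B by (rule assoc_mult_mat[of _ n 1 _ n _ n]) (use w bs C' in auto)
        finally have e: "(W3 * ?Ds + V4) * C' = W3 * B + V4 * C'" .
        have "W3 * B \<in> carrier_mat n n" "W4 * Q \<in> carrier_mat n n" "V4 * C' \<in> carrier_mat n n"
          using w v b C' by auto
        then show ?thesis unfolding e by (auto intro!: eq_matI simp: add.assoc add.left_commute simp del: index_mult_mat(1))
      qed
      ultimately have "W4 * Q + (W3 * ?Ds + V4) * C' = 1\<^sub>m n" by simp
      moreover have "W3 * ?Ds + V4 \<in> carrier_mat n n" using w v bs by auto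
      ultimately obtain S' where S': "S' \<in> carrier_mat n n" "mat_star star S' = S'" "Q - S' * C' \<in> mat_units n"
        using Suc.IH[OF b(4) C' w(4) _ _ QC] by blast
      \<comment> \<open>the entry $p - 1$ makes the corner $1$, and $d^*$, $d$ clear the rest of its row and column\<close>
      define S1 where "S1 = four_block_mat (P - 1\<^sub>m 1) ?Ds D S'"
      have S1: "S1 \<in> carrier_mat ?n ?n" unfolding S1_def using b S' by auto
      have "mat_star star (P - 1\<^sub>m 1) = P - 1\<^sub>m 1"
        using b by (simp add: mat_star_minus[of _ 1 1] Ps)
      then have S1s: "mat_star star S1 = S1"
        unfolding S1_def by (subst mat_star_four_block[of _ 1 1 _ n _ n]) (use b bs S' in auto)
      have "S1 * C1 = four_block_mat (P - 1\<^sub>m 1) B D (S' * C')"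
        unfolding S1_def C1b using b bs S' C' by (subst four_block_mult_Suc[where n = n]) (auto simp: B)
      then have "A1 - S1 * C1 = four_block_mat (1\<^sub>m 1) (0\<^sub>m 1 n) (0\<^sub>m n 1) (Q - S' * C')"
        unfolding A1b using b C' S' by (auto intro!: eq_matI simp del: index_mult_mat(1))
      then have unit1: "A1 - S1 * C1 \<in> mat_units ?n"
        using four_block_diag_unit[OF S'(3)] by simp
      \<comment> \<open>transport of the solution back to the original pair\<close>
      define S where "S = ?gs * S1 * g"
      have S: "S \<in> carrier_mat ?n ?n" unfolding S_def using gs g S1 by auto
      have "mat_star star S = S"
        unfolding S_def using gs g S1 by (simp add: mat_star_mult[of _ ?n ?n _ ?n] assoc S1s)
      moreover have "?gs * (A1 - S1 * C1) * h' = A - S * C"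
        unfolding A1_def C1_def S_def using g gs gs1 h A C S1
        by (simp add: assoc mult_cancel_inverse mult_minus_distrib_mat[of _ ?n ?n _ ?n]
            minus_mult_distrib_mat[of _ ?n ?n _ _ ?n])
      then have "A - S * C \<in> mat_units ?n"
        using mat_units_mult[OF mat_units_mult[OF gs(3) unit1] h(1)] by simp
      ultimately show ?thesis using S by blast
    qed
  qed
  then show thesis using that by blast
qed

end

section \<open>The maximal ideals of a \<open>*\<close>-local ring\<close>

lemma left_ideal_class_ring_iff:
  "left_ideal I (class_ring :: 'a::ring_1 ring) \<longleftrightarrow>
     0 \<in> I \<and> (\<forall>x\<in>I. \<forall>y\<in>I. x + y \<in> I) \<and> (\<forall>r. \<forall>x\<in>I. r * x \<in> I)"
proof
  assume l: "left_ideal I (class_ring :: 'a ring)"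
  then interpret additive_subgroup I "class_ring :: 'a ring" by (simp add: left_ideal_def)
  show "0 \<in> I \<and> (\<forall>x\<in>I. \<forall>y\<in>I. x + y \<in> I) \<and> (\<forall>r. \<forall>x\<in>I. r * x \<in> I)"
    using l zero_closed a_closed by (auto simp: left_ideal_def)
next
  assume r: "0 \<in> I \<and> (\<forall>x\<in>I. \<forall>y\<in>I. x + y \<in> I) \<and> (\<forall>r. \<forall>x\<in>I. r * x \<in> I)"
  have "subgroup I (add_monoid (class_ring :: 'a ring))"
  proof (rule group.subgroupI)
    show "Group.group (add_monoid (class_ring :: 'a ring))" by (rule abelian_group.a_group[OF ring.is_abelian_group[OF class_ring.ring_axioms]])
    fix a assume a: "a \<in> I"
    have "inv\<^bsub>add_monoid (class_ring :: 'a ring)\<^esub> a = - a"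
      using class_ring_simps by (metis a_inv_def)
    also have "\<dots> = - 1 * a" by simp
    finally show "inv\<^bsub>add_monoid (class_ring :: 'a ring)\<^esub> a \<in> I" using r a by metis
  qed (use r in auto)
  then show "left_ideal I (class_ring :: 'a ring)"
    using r by (simp add: left_ideal_def additive_subgroup_def)
qed

lemma ideal_class_ring_iff:
  "ideal I (class_ring :: 'a::ring_1 ring) \<longleftrightarrow>
     left_ideal I (class_ring :: 'a ring) \<and> (\<forall>r. \<forall>x\<in>I. x * r \<in> I)"
proof
  assume "ideal I (class_ring :: 'a ring)"
  then interpret ideal I "class_ring :: 'a ring" .
  show "left_ideal I (class_ring :: 'a ring) \<and> (\<forall>r. \<forall>x\<in>I. x * r \<in> I)"
    using additive_subgroup_axioms I_l_closed I_r_closed by (simp add: left_ideal_def)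
next
  assume "left_ideal I (class_ring :: 'a ring) \<and> (\<forall>r. \<forall>x\<in>I. x * r \<in> I)"
  then show "ideal I (class_ring :: 'a ring)"
    by (intro ideal.intro ideal_axioms.intro class_ring.ring_axioms) (auto simp: left_ideal_def)
qed

lemma left_ideal_proper_iff:
  "left_ideal I (class_ring :: 'a::ring_1 ring) \<Longrightarrow> I \<noteq> UNIV \<longleftrightarrow> 1 \<notin> I"
  unfolding left_ideal_class_ring_iff by (metis UNIV_I UNIV_eq_I mult.right_neutral)

lemma exists_maximal_left_ideal:
  assumes "left_ideal I (class_ring :: 'a::ring_1 ring)" "1 \<notin> I"
  obtains M where "maximal_left_ideal M (class_ring :: 'a ring)" "I \<subseteq> M"
proof -
  let ?A = "{J. left_ideal J (class_ring :: 'a ring) \<and> 1 \<notin> J \<and> I \<subseteq> J}"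
  have "\<exists>M\<in>?A. \<forall>J\<in>?A. M \<subseteq> J \<longrightarrow> J = M"
  proof (rule subset_Zorn_nonempty)
    show "?A \<noteq> {}" using assms by blast
    fix \<C> assume \<C>: "\<C> \<noteq> {}" "subset.chain ?A \<C>"
    then have mem: "J \<in> ?A" if "J \<in> \<C>" for J using that by (auto simp: subset.chain_def)
    have lin: "J \<subseteq> K \<or> K \<subseteq> J" if "J \<in> \<C>" "K \<in> \<C>" for J K
      using \<C>(2) that by (auto simp: subset_chain_def)
    have "left_ideal (\<Union>\<C>) (class_ring :: 'a ring)"
      unfolding left_ideal_class_ring_iff
    proof (intro conjI ballI allI)
      show "0 \<in> \<Union>\<C>" using \<C>(1) mem unfolding left_ideal_class_ring_iff by blast
    next
      fix x y assume "x \<in> \<Union>\<C>" "y \<in> \<Union>\<C>"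
      then obtain J K where "J \<in> \<C>" "x \<in> J" "K \<in> \<C>" "y \<in> K" by blast
      then show "x + y \<in> \<Union>\<C>" using lin[of J K] mem unfolding left_ideal_class_ring_iff by blast
    next
      fix r x assume "x \<in> \<Union>\<C>"
      then show "r * x \<in> \<Union>\<C>" using mem unfolding left_ideal_class_ring_iff by blast
    qed
    then show "\<Union>\<C> \<in> ?A" using mem \<C>(1) by blast
  qed
  then obtain M where "M \<in> ?A" and max: "\<forall>J\<in>?A. M \<subseteq> J \<longrightarrow> J = M" by (rule bexE)
  then have M: "left_ideal M (class_ring :: 'a ring)" "1 \<notin> M" "I \<subseteq> M" by auto
  have "maximal_left_ideal M (class_ring :: 'a ring)"
    unfolding maximal_left_ideal_def
  proof (intro conjI allI impI)
    fix J assume J: "left_ideal J (class_ring :: 'a ring) \<and> M \<subseteq> J"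
    then show "J = M \<or> J = carrier (class_ring :: 'a ring)"
      using left_ideal_proper_iff[of J] max[rule_format, of J] M(3) by auto
  qed (use M in auto)
  then show thesis using that M(3) by blast
qed

lemma maximal_left_ideal_sum:
  assumes M: "maximal_left_ideal M (class_ring :: 'a::ring_1 ring)"
    and J: "left_ideal J (class_ring :: 'a ring)" "\<not> J \<subseteq> M"
  shows "\<exists>x\<in>J. 1 - x \<in> M"
proof -
  let ?K = "{x + y | x y. x \<in> J \<and> y \<in> M}"
  have lM: "left_ideal M (class_ring :: 'a ring)" using M by (simp add: maximal_left_ideal_def)
  have "left_ideal ?K (class_ring :: 'a ring)"
    unfolding left_ideal_class_ring_iff
  proof (intro conjI ballI allI)
    have "0 = 0 + (0::'a)" by simp
    then show "0 \<in> ?K" using lM J(1) unfolding left_ideal_class_ring_iff by blast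
  next
    fix u v assume "u \<in> ?K" "v \<in> ?K"
    then obtain x y x' y' where uv: "u = x + y" "v = x' + y'" "x \<in> J" "y \<in> M" "x' \<in> J" "y' \<in> M" by blast
    then have "u + v = (x + x') + (y + y')" by (simp add: algebra_simps)
    moreover have "x + x' \<in> J" "y + y' \<in> M" using uv lM J(1) unfolding left_ideal_class_ring_iff by auto
    ultimately show "u + v \<in> ?K" by blast
  next
    fix r u assume "u \<in> ?K"
    then obtain x y where u: "u = x + y" "x \<in> J" "y \<in> M" by blast
    then have "r * u = r * x + r * y" by (simp add: algebra_simps)
    moreover have "r * x \<in> J" "r * y \<in> M" using u lM J(1) unfolding left_ideal_class_ring_iff by auto
    ultimately show "r * u \<in> ?K" by blast
  qed
  moreover have "M \<subseteq> ?K"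
  proof
    fix y assume "y \<in> M"
    moreover have "y = 0 + y" by simp
    ultimately show "y \<in> ?K" using J(1) unfolding left_ideal_class_ring_iff by blast
  qed
  moreover have "J \<subseteq> ?K"
  proof
    fix y assume "y \<in> J"
    moreover have "y = y + 0" by simp
    ultimately show "y \<in> ?K" using lM unfolding left_ideal_class_ring_iff by blast
  qed
  ultimately have "?K = UNIV" using M J(2) unfolding maximal_left_ideal_def
    by (metis (no_types, lifting) partial_object.select_convs(1))
  then have "1 \<in> ?K" by (rule ssubst) (rule UNIV_I)
  then obtain x y where "1 = x + y" "x \<in> J" "y \<in> M" by blast
  moreover from this have "1 - x = y" by (metis add_diff_cancel_left')
  ultimately show ?thesis by metis
qed

lemma left_ideal_principal:
  "left_ideal (range (\<lambda>r. r * x)) (class_ring :: 'a::ring_1 ring)"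
  unfolding left_ideal_class_ring_iff
proof (intro conjI ballI allI)
  show "0 \<in> range (\<lambda>r. r * x)" by (metis mult_zero_left rangeI)
next
  fix u v assume "u \<in> range (\<lambda>r. r * x)" "v \<in> range (\<lambda>r. r * x)"
  then obtain a b where "u = a * x" "v = b * x" by blast
  then have "u + v = (a + b) * x" by (simp add: distrib_right)
  then show "u + v \<in> range (\<lambda>r. r * x)" by blast
next
  fix r u assume "u \<in> range (\<lambda>r. r * x)"
  then obtain a where "u = a * x" by blast
  then have "r * u = (r * a) * x" by (simp add: mult.assoc)
  then show "r * u \<in> range (\<lambda>r. r * x)" by blast
qed

lemma involution_class_ring:
  assumes "ring_with_involution (class_ring :: 'a::ring_1 ring) star"
  shows "involution star"
proof -
  interpret ring_with_involution "class_ring :: 'a ring" star by fact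
  show ?thesis using star_add star_mult star_star by unfold_locales auto
qed

context involution
begin

lemma star_image_iff: "x \<in> star ` I \<longleftrightarrow> star x \<in> I"
  by (metis image_iff star_star)

lemma ideal_star_image:
  assumes "ideal I (class_ring :: 'a ring)"
  shows "ideal (star ` I) (class_ring :: 'a ring)"
  using assms
  by (simp add: ideal_class_ring_iff left_ideal_class_ring_iff star_image_iff Ball_def star_add star_mult)

text \<open>
  A stable ideal $J$ inside $M$ also lies in $M^*$. A stable ideal containing $M \cap M^*$ but not
  contained in $M$ has an element $x$ with $p = 1 - x \in M$; then
  $1 = x + p(x^* + p^*)$, where $pp^* \in M \cap M^* \subseteq J$, so $1 \in J$.
\<close>

lemma stable_maximal_Int_star:
  assumes M: "maximal_left_ideal M (class_ring :: 'a ring)" and I: "ideal M (class_ring :: 'a ring)"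
  shows "stable_maximal_ideal (M \<inter> star ` M) (class_ring :: 'a ring) star"
proof -
  have lM: "left_ideal M (class_ring :: 'a ring)" and M1: "1 \<notin> M"
    using M left_ideal_proper_iff[of M] by (auto simp: maximal_left_ideal_def)
  have inv: "x \<in> star ` (M \<inter> star ` M) \<longleftrightarrow> x \<in> M \<inter> star ` M" for x
    by (auto simp: star_image_iff)
  have int: "ideal (M \<inter> star ` M) (class_ring :: 'a ring)"
    using I ideal_star_image[OF I] by (auto simp: ideal_class_ring_iff left_ideal_class_ring_iff)
  show ?thesis unfolding stable_maximal_ideal_def
  proof (intro conjI allI impI)
    show "stable_ideal (M \<inter> star ` M) (class_ring :: 'a ring) star"
      using int inv by (auto simp only: stable_ideal_def set_eq_iff)
    show "M \<inter> star ` M \<noteq> carrier (class_ring :: 'a ring)" using M1 by auto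
    fix J assume J: "stable_ideal J (class_ring :: 'a ring) star \<and> M \<inter> star ` M \<subseteq> J"
    then have iJ: "ideal J (class_ring :: 'a ring)" and sJ: "\<And>x. x \<in> J \<Longrightarrow> star x \<in> J"
      by (auto simp: stable_ideal_def)
    then have lJ: "left_ideal J (class_ring :: 'a ring)" by (simp add: ideal_class_ring_iff)
    show "J = M \<inter> star ` M \<or> J = carrier (class_ring :: 'a ring)"
    proof (cases "J \<subseteq> M")
      case True
      then have "J \<subseteq> M \<inter> star ` M" using sJ unfolding subset_iff Int_iff star_image_iff by blast
      then show ?thesis using J by blast
    next
      case False
      then obtain x where x: "x \<in> J" "1 - x \<in> M" using maximal_left_ideal_sum[OF M lJ] by blast
      define p where "p = 1 - x"
      have "p * star p \<in> M \<inter> star ` M"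
        using I x(2) by (auto simp: star_image_iff star_mult p_def ideal_class_ring_iff)
      then have "p * star p \<in> J" using J by blast
      moreover have "p * star x \<in> J" using lJ sJ[OF x(1)] by (simp add: left_ideal_class_ring_iff)
      ultimately have "x + (p * star x + p * star p) \<in> J"
        using x(1) lJ by (simp add: left_ideal_class_ring_iff)
      also have "x + (p * star x + p * star p) = 1"
        by (simp add: p_def star_diff algebra_simps)
      finally show ?thesis using left_ideal_proper_iff[OF lJ] by auto
    qed
  qed
qed

end

text \<open>
  Every maximal left ideal $K$ is $M$ or $N$: uniqueness of the maximal stable ideal gives
  $MN \subseteq M \cap N = K \cap K^* \subseteq K$, and $K$ is prime, so it contains $M$ or $N$;
  then maximality of $M$, applied to $K$ or to $K^*$, gives equality. An element outside
  $M \cup N$ thus generates the whole ring as a left ideal, and so does its left inverse.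
\<close>

lemma star_local_conjugate_ideals:
  fixes star :: "'a::ring_1 \<Rightarrow> 'a"
  assumes "star_local_ring (class_ring :: 'a ring) star"
  obtains M where "conjugate_ideals star M (star ` M)"
proof -
  interpret L: star_local_ring "class_ring :: 'a ring" star by fact
  interpret involution star by (rule involution_class_ring) unfold_locales
  have two_sided: "ideal I (class_ring :: 'a ring)" if "maximal_left_ideal I (class_ring :: 'a ring)" for I
    using L.l_max that by (simp add: l_maximal_def)
  have "left_ideal {0} (class_ring :: 'a ring)" by (simp add: left_ideal_class_ring_iff)
  then obtain M where M: "maximal_left_ideal M (class_ring :: 'a ring)"
    using exists_maximal_left_ideal[of "{0}"] by auto
  define N where "N = star ` M"
  have iM: "ideal M (class_ring :: 'a ring)" using M by (rule two_sided)
  then have iN: "ideal N (class_ring :: 'a ring)" unfolding N_def by (rule ideal_star_image)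
  have lM: "left_ideal M (class_ring :: 'a ring)" using iM by (simp add: ideal_class_ring_iff)
  have lN: "left_ideal N (class_ring :: 'a ring)" using iN by (simp add: ideal_class_ring_iff)
  have M1: "1 \<notin> M" using M left_ideal_proper_iff[of M] by (auto simp: maximal_left_ideal_def)
  then have N1: "1 \<notin> N" by (simp add: N_def star_image_iff)
  have only: "K = M \<or> K = N" if K: "maximal_left_ideal K (class_ring :: 'a ring)" for K
  proof -
    have iK: "ideal K (class_ring :: 'a ring)" using K by (rule two_sided)
    then have lK: "left_ideal K (class_ring :: 'a ring)" by (simp add: ideal_class_ring_iff)
    have K1: "1 \<notin> K" using K left_ideal_proper_iff[OF lK] by (auto simp: maximal_left_ideal_def)
    have max: "J = I" if "left_ideal J (class_ring :: 'a ring)" "maximal_left_ideal I (class_ring :: 'a ring)"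
      "I \<subseteq> J" "1 \<notin> J" for I J
      using that left_ideal_proper_iff[of J] by (auto simp: maximal_left_ideal_def)
    have "M \<inter> N = K \<inter> star ` K"
      using L.unique_stable_maximal stable_maximal_Int_star[OF M iM] stable_maximal_Int_star[OF K iK]
      unfolding N_def by blast
    then have MN: "M \<inter> N \<subseteq> K" by blast
    have "M \<subseteq> K \<or> N \<subseteq> K"
    proof (rule ccontr)
      assume "\<not> (M \<subseteq> K \<or> N \<subseteq> K)"
      then have nsub: "\<not> M \<subseteq> K" "\<not> N \<subseteq> K" by auto
      obtain x y where xy: "x \<in> M" "1 - x \<in> K" "y \<in> N" "1 - y \<in> K"
        using maximal_left_ideal_sum[OF K lM nsub(1)] maximal_left_ideal_sum[OF K lN nsub(2)] by blast
      have "x * y \<in> K"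
        using MN xy iM lN by (auto simp: ideal_class_ring_iff left_ideal_class_ring_iff)
      moreover have "(1 - x) * y \<in> K" using xy iK by (simp add: ideal_class_ring_iff)
      ultimately have "x * y + ((1 - x) * y + (1 - y)) \<in> K"
        using xy(4) lK by (simp add: left_ideal_class_ring_iff)
      then show False using K1 by (simp add: algebra_simps)
    qed
    then show ?thesis
    proof
      assume "M \<subseteq> K"
      then show ?thesis using max[OF lK M _ K1] by blast
    next
      assume "N \<subseteq> K"
      then have "M \<subseteq> star ` K" by (auto simp: N_def star_image_iff)
      moreover have "left_ideal (star ` K) (class_ring :: 'a ring)"
        using ideal_star_image[OF iK] by (simp add: ideal_class_ring_iff)
      moreover have "1 \<notin> star ` K" using K1 by (simp add: star_image_iff)
      ultimately have "star ` K = M" using max[OF _ M] by blast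
      then show ?thesis by (auto simp: N_def star_image_iff image_image)
    qed
  qed
  have left_inverse: "\<exists>y. y * x = 1" if "x \<notin> M" "x \<notin> N" for x
  proof (rule ccontr)
    assume no: "\<nexists>y. y * x = 1"
    then have "1 \<notin> range (\<lambda>r. r * x)" by (auto simp: image_iff)
    then obtain K where K: "maximal_left_ideal K (class_ring :: 'a ring)" "range (\<lambda>r. r * x) \<subseteq> K"
      using exists_maximal_left_ideal[OF left_ideal_principal] by blast
    then have "1 * x \<in> K" by blast
    then show False using only[OF K(1)] that by auto
  qed
  have unit: "\<exists>y. x * y = 1 \<and> y * x = 1" if x: "x \<notin> M" "x \<notin> N" for x
  proof -
    obtain y where y: "y * x = 1" using left_inverse[OF x] by blast
    have "y \<notin> M" using y M1 iM by (metis ideal_class_ring_iff)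
    moreover have "y \<notin> N" using y N1 iN by (metis ideal_class_ring_iff)
    ultimately obtain z where z: "z * y = 1" using left_inverse by blast
    have "z = x" by (metis mult.assoc mult.left_neutral mult.right_neutral y z)
    then show ?thesis using y z by blast
  qed
  have "conjugate_ideals star M N"
  proof (intro conjugate_ideals.intro conjugate_ideals_axioms.intro proper_ideal.intro involution_axioms)
    assume "M \<noteq> N"
    have "\<not> N \<subseteq> M"
    proof
      assume NM: "N \<subseteq> M"
      have "M \<subseteq> N"
      proof
        fix x assume "x \<in> M"
        then have "star x \<in> M" using NM by (auto simp: N_def)
        then show "x \<in> N" by (simp add: N_def star_image_iff)
      qed
      then show False using NM \<open>M \<noteq> N\<close> by blast
    qed
    then show "\<exists>e\<in>N. 1 - e \<in> M" by (rule maximal_left_ideal_sum[OF M lN])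
  qed (use iM iN M1 N1 unit in \<open>auto simp: ideal_class_ring_iff left_ideal_class_ring_iff N_def\<close>)
  then show thesis using that by (simp add: N_def)
qed

section \<open>Matrix rings over \<open>*\<close>-local rings\<close>

lemma (in involution) ring_mat_involution:
  "ring_with_involution (ring_mat TYPE('a) n ()) (mat_star star)"
  by (intro ring_with_involution.intro ring_with_involution_axioms.intro ring_mat_ring_1)
     (auto simp: ring_mat_simps mat_star_add[of _ n n] mat_star_mult[of _ n n _ n])

theorem theorem3p1p1:
  fixes star :: "'a::ring_1 \<Rightarrow> 'a" and n :: nat
  assumes "star_local_ring (class_ring :: 'a ring) star"
    and "n \<ge> 1"
  shows "star_Euclidean_ring (ring_mat TYPE('a) n ()) (mat_star star)"
proof -
  obtain M where "conjugate_ideals star M (star ` M)"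
    using star_local_conjugate_ideals[OF assms(1)] by blast
  then interpret conjugate_ideals star M "star ` M" .
  let ?R = "ring_mat TYPE('a) n ()"
  show ?thesis
  proof (intro star_Euclidean_ring.intro star_Euclidean_ring_axioms.intro ring_mat_involution)
    fix a c :: "'a mat"
    assume ac: "a \<in> carrier ?R" "c \<in> carrier ?R"
      and unimodular: "{x \<otimes>\<^bsub>?R\<^esub> a \<oplus>\<^bsub>?R\<^esub> y \<otimes>\<^bsub>?R\<^esub> c | x y. x \<in> carrier ?R \<and> y \<in> carrier ?R} = carrier ?R"
      and sym: "mat_star star a \<otimes>\<^bsub>?R\<^esub> c \<in> sym_elems ?R (mat_star star)"
    have a: "a \<in> carrier_mat n n" and c: "c \<in> carrier_mat n n" using ac by (auto simp: ring_mat_simps)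
    have "1\<^sub>m n \<in> {x * a + y * c | x y. x \<in> carrier_mat n n \<and> y \<in> carrier_mat n n}"
      using unimodular by (simp add: ring_mat_simps)
    then obtain x y where xy: "x \<in> carrier_mat n n" "y \<in> carrier_mat n n" "x * a + y * c = 1\<^sub>m n"
      by auto
    have "mat_star star a * c = mat_star star c * a"
      using sym a c by (simp add: sym_elems_def ring_mat_simps mat_star_mult[of _ n n _ n])
    then obtain s where s: "s \<in> carrier_mat n n" "mat_star star s = s" "a - s * c \<in> mat_units n"
      using symmetric_reduction[OF a c xy] by blast
    let ?r = "\<lambda>i::int. if i = - 1 then a else if i = 0 then c else a - s * c"
    have "a = s * c + (a - s * c)"
      using a c s by (auto intro!: eq_matI simp del: index_mult_mat(1))
    then show "\<exists>(m::int) (s :: int \<Rightarrow> 'a mat) (r :: int \<Rightarrow> 'a mat).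
       m \<ge> 1 \<and> r (-1) = a \<and> r 0 = c \<and>
       (\<forall>i \<in> {0..m-1}. s i \<in> sym_elems ?R (mat_star star)) \<and>
       (\<forall>i \<in> {1..m-1}. r i \<in> carrier ?R) \<and>
       r m \<in> Units ?R \<and>
       (\<forall>i \<in> {0..m-1}. r (i - 1) = s i \<otimes>\<^bsub>?R\<^esub> r i \<oplus>\<^bsub>?R\<^esub> r (i + 1))"
      using s by (intro exI[of _ 1] exI[of _ "\<lambda>_. s"] exI[of _ ?r]) (auto simp: sym_elems_def ring_mat_simps)
  qed
qed

end
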